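(* Let $R$ be a commutative ring with identity and let $T=(V,E,\alpha)$ be a finite edge-labeled tree. The tuple $\mathbf{p}\in R^{|V|}$ is a generalized spline $\mathbf{p}\in R_T$ if and only if given any two vertices $v_i,v_j\in V$ we may write $$\mathbf{p}_{v_j}=\mathbf{p}_{v_i}+\alpha_{i,i_1}+\cdots+\alpha_{i_{m-1},i_m}+\alpha_{i_m,j}\quad\text{for some }\alpha_{l,k}\in\alpha(e_{l,k}),$$ where $v_i,v_{i_1},\ldots,v_{i_m},v_j$ are the vertices in the unique path connecting $v_i$ and $v_j$ in the tree $T$. Furthermore, $\mathbf{p}$ is nontrivial if and only if at least one of the $\alpha_{l,k}$ is nonzero.
   Context: An edge-labeling function on a graph $G=(V,E)$ is a map $\alpha$ from $E$ to the nonzero ideals of $R$; $e_{l,k}=v_lv_k$ denotes the edge joining $v_l$ and $v_k$. The ring of generalized splines is $R_G=\{\mathbf{p}\in\bigoplus_{v\in V}R:\mathbf{p}_u-\mathbf{p}_v\in\alpha(uv)\text{ for every edge }uv\in E\}$. A generalized spline is nontrivial if it is not in $R\mathbf{1}$, where $\mathbf{1}_v=1$ for all $v\in V$. *)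

theory Defs
  imports
    "HOL-Algebra.Ideal"
    "HOL-Library.FuncSet"
    "Graph_Theory.Digraph_Component_Vwalk"
begin

text \<open>
  A finite simple graph is a \<open>graph\<close> of the library: a finite, loop-free, symmetric digraph
  without parallel arcs, so that an edge \<open>uv\<close> is the pair of arcs \<open>(u, v)\<close> and \<open>(v, u)\<close> of
  \<open>arcs_ends G\<close>.
  The library notions \<open>cycle\<close> and \<open>tree\<close> are directed: in a symmetric digraph the walk
  \<open>u, v, u\<close> along an edge is already a cycle. Hence cycles are required here to have at least
  three edges.
\<close>

definition undirected_cycle :: "('v, 'e) pre_digraph \<Rightarrow> 'v list \<Rightarrow> bool" where
  "undirected_cycle G c \<longleftrightarrow>
     vwalk c G \<and> hd c = last c \<and> distinct (tl c) \<and> vwalk_length c \<ge> 3"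

definition undirected_tree :: "('v, 'e) pre_digraph \<Rightarrow> bool" where
  "undirected_tree G \<longleftrightarrow> graph G \<and> connected G \<and> \<not> (\<exists>c. undirected_cycle G c)"

text \<open>The list of vertices of the path from \<open>u\<close> to \<open>v\<close>; for its existence and uniqueness in a
  tree see \<open>undirected_tree_ex1_path\<close> below.\<close>

definition tree_path :: "('v, 'e) pre_digraph \<Rightarrow> 'v \<Rightarrow> 'v \<Rightarrow> 'v list" where
  "tree_path G u v = (THE xs. vpath xs G \<and> hd xs = u \<and> last xs = v)"

text \<open>Labels are attached to unordered edges \<open>{u, v}\<close>, so that \<open>\<alpha>(uv) = \<alpha>(vu)\<close>.\<close>

definition edge_labeling ::
    "('r, 'm) ring_scheme \<Rightarrow> ('v, 'e) pre_digraph \<Rightarrow> ('v set \<Rightarrow> 'r set) \<Rightarrow> bool" where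
  "edge_labeling R G \<alpha> \<longleftrightarrow>
     (\<forall>(u, v) \<in> arcs_ends G. ideal (\<alpha> {u, v}) R \<and> \<alpha> {u, v} \<noteq> {\<zero>\<^bsub>R\<^esub>})"

text \<open>For a finite vertex set the direct sum of copies of \<open>R\<close> consists of all functions from the
  vertices to \<open>R\<close>.\<close>

definition splines ::
    "('r, 'm) ring_scheme \<Rightarrow> ('v, 'e) pre_digraph \<Rightarrow> ('v set \<Rightarrow> 'r set) \<Rightarrow> ('v \<Rightarrow> 'r) set" where
  "splines R G \<alpha> =
     {p \<in> verts G \<rightarrow>\<^sub>E carrier R. \<forall>(u, v) \<in> arcs_ends G. p u \<ominus>\<^bsub>R\<^esub> p v \<in> \<alpha> {u, v}}"

definition trivial_splines ::
    "('r, 'm) ring_scheme \<Rightarrow> ('v, 'e) pre_digraph \<Rightarrow> ('v \<Rightarrow> 'r) set" where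
  "trivial_splines R G = {(\<lambda>v\<in>verts G. r \<otimes>\<^bsub>R\<^esub> \<one>\<^bsub>R\<^esub>) | r. r \<in> carrier R}"

definition nontrivial_spline ::
    "('r, 'm) ring_scheme \<Rightarrow> ('v, 'e) pre_digraph \<Rightarrow> ('v set \<Rightarrow> 'r set) \<Rightarrow> ('v \<Rightarrow> 'r) \<Rightarrow> bool" where
  "nontrivial_spline R G \<alpha> p \<longleftrightarrow> p \<in> splines R G \<alpha> \<and> p \<notin> trivial_splines R G"

text \<open>
  With \<open>i, i\<^sub>1, \<dots>, i\<^sub>m, j\<close> the path from \<open>i\<close> to \<open>j\<close>:
  \<open>p\<^sub>j = p\<^sub>i + a\<^bsub>i,i\<^sub>1\<^esub> + \<dots> + a\<^bsub>i\<^sub>m,j\<^esub>\<close>, where \<open>a\<^bsub>l,k\<^esub> \<in> \<alpha>(e\<^bsub>l,k\<^esub>)\<close> for every edge of the path,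
  traversed from \<open>l\<close> to \<open>k\<close>.
\<close>

definition path_expansion ::
    "('r, 'm) ring_scheme \<Rightarrow> ('v, 'e) pre_digraph \<Rightarrow> ('v set \<Rightarrow> 'r set) \<Rightarrow> ('v \<Rightarrow> 'r) \<Rightarrow>
     ('v \<Rightarrow> 'v \<Rightarrow> 'r) \<Rightarrow> 'v \<Rightarrow> 'v \<Rightarrow> bool" where
  "path_expansion R G \<alpha> p a i j \<longleftrightarrow>
     (\<forall>(l, k) \<in> set (vwalk_arcs (tree_path G i j)). a l k \<in> \<alpha> {l, k}) \<and>
     p j = foldl (\<oplus>\<^bsub>R\<^esub>) (p i) (map (\<lambda>(l, k). a l k) (vwalk_arcs (tree_path G i j)))"

lemma set_vwalk_arcs_rev: "set (vwalk_arcs (rev xs)) = (set (vwalk_arcs xs))\<inverse>"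
proof (induction xs rule: vwalk_arcs.induct)
  case (3 x y xs)
  have "vwalk_arcs (rev (x # y # xs)) = vwalk_arcs (rev (y # xs)) @ [(y, x)]"
    using vwalk_arcs_append[of "rev (y # xs)" "[x]"] by simp
  then show ?case using 3 by auto
qed auto

lemma vwalk_rev:
  assumes "symmetric G" "vwalk xs G"
  shows "vwalk (rev xs) G"
  using assms by (auto simp: vwalk_def set_vwalk_arcs_rev symmetric_def sym_def)

lemma vwalk_prefix: "vwalk (xs @ ys) G \<Longrightarrow> xs \<noteq> [] \<Longrightarrow> vwalk xs G"
  using set_vwalk_arcs_append1[of xs ys] by (auto simp: vwalk_def)

lemma vwalk_glue:
  assumes "vwalk (xs @ [w]) G" "vwalk (w # ys) G"
  shows "vwalk (xs @ w # ys) G"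
proof (cases "xs = []")
  case False
  have "vwalk_arcs (xs @ w # ys) = vwalk_arcs (xs @ [w]) @ vwalk_arcs (w # ys)"
    using False by (simp add: vwalk_arcs_append)
  then show ?thesis using assms by (auto simp: vwalk_def)
qed (use assms in simp)

lemma forked_paths_cycle:
  assumes sym: "symmetric G"
    and p: "vpath (u # p) G" and q: "vpath (u # q) G" and ne: "p \<noteq> []" "q \<noteq> []"
    and hds: "hd p \<noteq> hd q" and last_eq: "last p = last q"
  shows "\<exists>c. undirected_cycle G c"
proof -
  have "last p \<in> set p" using ne(1) by simp
  moreover have "last p \<in> set q" using ne(2) unfolding last_eq by simp
  ultimately have "\<exists>x\<in>set p. x \<in> set q" by blast
  then obtain xs w xs' where xs: "p = xs @ w # xs'" "w \<in> set q" "\<forall>x\<in>set xs. x \<notin> set q"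
    using split_list_first_prop[of p "\<lambda>x. x \<in> set q"] by blast
  obtain ys ys' where ys: "q = ys @ w # ys'" using xs(2) by (meson split_list)
  let ?c = "(u # xs) @ w # rev (u # ys)"
  have "vwalk (u # xs @ [w]) G"
    using p xs(1) vwalk_prefix[of "u # xs @ [w]" xs' G] by (simp add: vpath_def)
  moreover have "vwalk (u # ys @ [w]) G"
    using q ys vwalk_prefix[of "u # ys @ [w]" ys' G] by (simp add: vpath_def)
  then have "vwalk (w # rev (u # ys)) G" using vwalk_rev[OF sym, of "u # ys @ [w]"] by simp
  ultimately have "vwalk ?c G" using vwalk_glue[of "u # xs" w G "rev (u # ys)"] by simp
  moreover have "distinct (tl ?c)" using p q xs ys by (auto simp: vpath_def)
  moreover have "xs \<noteq> [] \<or> ys \<noteq> []" using hds xs(1) ys by auto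
  then have "vwalk_length ?c \<ge> 3" by (cases xs; cases ys) auto
  ultimately have "undirected_cycle G ?c" by (auto simp: undirected_cycle_def)
  then show ?thesis by blast
qed

lemma acyclic_path_unique:
  assumes "symmetric G" "\<not> (\<exists>c. undirected_cycle G c)"
    and "vpath p G" "vpath q G" "hd p = hd q" "last p = last q"
  shows "p = q"
  using assms(3-)
proof (induction p arbitrary: q)
  case Nil
  then show ?case by (auto simp: vpath_def vwalk_def)
next
  case (Cons u p)
  then obtain q' where q: "q = u # q'" by (cases q) (auto simp: vpath_def vwalk_def)
  have dist: "u \<notin> set p" "u \<notin> set q'" using Cons.prems q by (auto simp: vpath_def)
  show ?case
  proof (cases "p = [] \<or> q' = []")
    case True
    then show ?thesis using Cons.prems q dist by (auto split: if_splits)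
  next
    case False
    then have "vpath p G" "vpath q' G"
      using Cons.prems q by (auto simp: vpath_def elim: vwalk_consE)
    moreover have "hd p = hd q'"
      using forked_paths_cycle[OF assms(1), of u p q'] False Cons.prems q assms(2) by auto
    moreover have "last p = last q'"
      using False Cons.prems q by simp
    ultimately have "p = q'" using Cons.IH by blast
    then show ?thesis using q by simp
  qed
qed

lemma undirected_tree_ex1_path:
  assumes "undirected_tree G" "u \<in> verts G" "v \<in> verts G"
  shows "\<exists>!xs. vpath xs G \<and> hd xs = u \<and> last xs = v"
proof -
  interpret graph G using assms(1) by (simp add: undirected_tree_def)
  have "u \<rightarrow>\<^sup>*\<^bsub>G\<^esub> v"
    using assms symmetric_connected_imp_strongly_connected[OF sym_arcs]
    by (auto simp: undirected_tree_def strongly_connected_def)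
  then obtain xs where "vpath xs G" "hd xs = u" "last xs = v"
    using reachable_vpath_conv by metis
  then show ?thesis
    using acyclic_path_unique[OF sym_arcs] assms(1) unfolding undirected_tree_def by metis
qed

end

theory Submission
  imports Defs
begin

text \<open>
  On an edge \<open>lk\<close> the path expansion reads \<open>p\<^sub>k = p\<^sub>l + a\<^bsub>l,k\<^esub>\<close>, which forces
  \<open>a\<^bsub>l,k\<^esub> = p\<^sub>k - p\<^sub>l\<close>. Conversely, with this choice of \<open>a\<close> the sum along any path telescopes.
  Hence the expansions exist exactly when all edge differences lie in their ideals, and since the
  tree is connected \<open>p\<close> is constant exactly when all these differences vanish.
\<close>

lemma tree_path:
  assumes "undirected_tree T" "i \<in> verts T" "j \<in> verts T"
  shows "vpath (tree_path T i j) T" "hd (tree_path T i j) = i" "last (tree_path T i j) = j"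
  using theI'[OF undirected_tree_ex1_path[OF assms]] by (auto simp: tree_path_def)

text \<open>Adjacent vertices are distinct, so \<open>[u, v]\<close> is a path, and paths in a tree
  are unique. An expansion between adjacent vertices thus involves a single label.\<close>

lemma tree_path_edge:
  assumes "undirected_tree T" "(u, v) \<in> arcs_ends T"
  shows "tree_path T u v = [u, v]"
proof -
  interpret graph T using assms(1) by (simp add: undirected_tree_def)
  have uv: "u \<in> verts T" "v \<in> verts T" "u \<noteq> v"
    using assms(2) adj_in_verts adj_not_same by auto
  then have "vpath [u, v] T" using assms(2) by (auto simp: vpath_def vwalk_def)
  then show ?thesis
    unfolding tree_path_def
    using the1_equality[OF undirected_tree_ex1_path[OF assms(1) uv(1,2)], of "[u, v]"] by simp
qed

text \<open>Telescoping: folding in the first difference turns the accumulator \<open>p x\<close>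
  into \<open>p y\<close>, the starting value for the rest of the list.\<close>

lemma (in abelian_group) foldl_differences_vwalk:
  assumes "xs \<noteq> []" "p ` set xs \<subseteq> carrier G"
  shows "foldl (\<oplus>\<^bsub>G\<^esub>) (p (hd xs)) (map (\<lambda>(l, k). p k \<ominus> p l) (vwalk_arcs xs)) = p (last xs)"
  using assms
proof (induction xs rule: vwalk_arcs.induct)
  case (3 x y xs)
  have c: "p x \<in> carrier G" "p y \<in> carrier G" using 3(3) by auto
  have "p x \<oplus>\<^bsub>G\<^esub> (p y \<ominus> p x) = p y"
    using r_neg2[OF c] a_comm[OF c(2) a_inv_closed[OF c(1)]] by (simp add: minus_eq)
  then show ?case using 3 by simp
qed auto

lemma (in abelian_group) foldl_add_zeros:
  assumes "x \<in> carrier G" "\<forall>y\<in>set ys. y = \<zero>"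
  shows "foldl (\<oplus>\<^bsub>G\<^esub>) x ys = x"
  using assms by (induction ys) auto

lemma path_expansion_edge:
  assumes "undirected_tree T" "(u, v) \<in> arcs_ends T" "path_expansion R T \<alpha> p a u v"
  shows "a u v \<in> \<alpha> {u, v}" "p v = p u \<oplus>\<^bsub>R\<^esub> a u v"
  using assms(3) by (simp_all add: path_expansion_def tree_path_edge[OF assms(1,2)])

lemma path_expansion_edge_difference:
  assumes "cring R" "undirected_tree T" "edge_labeling R T \<alpha>" "p \<in> verts T \<rightarrow>\<^sub>E carrier R"
    and e: "(u, v) \<in> arcs_ends T" and "path_expansion R T \<alpha> p a u v"
  shows "a u v = p v \<ominus>\<^bsub>R\<^esub> p u"
proof -
  interpret cring R by fact
  interpret graph T using assms(2) by (simp add: undirected_tree_def)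
  \<comment> \<open>Ring laws hold only on the carrier; the ideal places \<open>a u v\<close> there,
    so that \<open>p u\<close> can be cancelled.\<close>
  have "ideal (\<alpha> {u, v}) R" using assms(3) e by (auto simp: edge_labeling_def)
  then have "a u v \<in> carrier R"
    using path_expansion_edge(1)[OF assms(2) e assms(6)] ideal.Icarr by fast
  moreover have "p u \<in> carrier R" using assms(4) adj_in_verts(1)[OF e] by (auto simp: PiE_def)
  ultimately show ?thesis
    using path_expansion_edge(2)[OF assms(2) e assms(6)]
    by (simp add: minus_eq a_comm[of "p u"] a_assoc r_neg)
qed

text \<open>The spline condition concerns single edges, so expansions between adjacent vertices
  suffice. The coefficients \<open>a\<close> may therefore vary with the pair of endpoints.\<close>

lemma spline_if_path_expansions:
  assumes "cring R" "undirected_tree T" "edge_labeling R T \<alpha>" "p \<in> verts T \<rightarrow>\<^sub>E carrier R"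
    and ex: "\<forall>i\<in>verts T. \<forall>j\<in>verts T. \<exists>a. path_expansion R T \<alpha> p a i j"
  shows "p \<in> splines R T \<alpha>"
proof -
  interpret graph T using assms(2) by (simp add: undirected_tree_def)
  have "p u \<ominus>\<^bsub>R\<^esub> p v \<in> \<alpha> {u, v}" if "(u, v) \<in> arcs_ends T" for u v
  proof -
    \<comment> \<open>The expansion from \<open>v\<close> to \<open>u\<close> yields
      \<open>p u - p v\<close>, with the sign required by \<open>splines\<close>.\<close>
    have e: "(v, u) \<in> arcs_ends T" using that sym_arcs by (auto simp: symmetric_def dest: symD)
    obtain a where "path_expansion R T \<alpha> p a v u" using ex adj_in_verts[OF e] by blast
    then show ?thesis
      using path_expansion_edge(1)[OF assms(2) e] path_expansion_edge_difference[OF assms(1-4) e]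
      by (simp add: insert_commute)
  qed
  then show ?thesis using assms(4) by (auto simp: splines_def)
qed

text \<open>The edge differences lie in their ideals and telescope along the path. The witness does
  not mention \<open>i\<close> or \<open>j\<close>, so one \<open>a\<close> serves all pairs of
  vertices.\<close>

lemma spline_path_expansion:
  assumes "cring R" "undirected_tree T" "p \<in> splines R T \<alpha>" "i \<in> verts T" "j \<in> verts T"
  shows "path_expansion R T \<alpha> p (\<lambda>l k. p k \<ominus>\<^bsub>R\<^esub> p l) i j"
proof -
  interpret cring R by fact
  interpret graph T using assms(2) by (simp add: undirected_tree_def)
  let ?xs = "tree_path T i j"
  have walk: "vwalk ?xs T" using tree_path(1)[OF assms(2,4,5)] by (simp add: vpath_def)
  have "p k \<ominus>\<^bsub>R\<^esub> p l \<in> \<alpha> {l, k}" if "(l, k) \<in> set (vwalk_arcs ?xs)" for l k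
  proof -
    have "(l, k) \<in> arcs_ends T" using walk that by (auto simp: vwalk_def)
    \<comment> \<open>Reversing the arc turns the spline condition into one on
      \<open>p k - p l\<close>; the label of the unordered edge is the same.\<close>
    then have "(k, l) \<in> arcs_ends T" using sym_arcs by (auto simp: symmetric_def dest: symD)
    then have "p k \<ominus>\<^bsub>R\<^esub> p l \<in> \<alpha> {k, l}" using assms(3) by (auto simp: splines_def)
    then show ?thesis by (simp add: insert_commute)
  qed
  moreover have "?xs \<noteq> []" "p ` set ?xs \<subseteq> carrier R"
    using walk assms(3) by (auto simp: vwalk_def splines_def)
  ultimately show ?thesis
    using foldl_differences_vwalk[of ?xs p] tree_path(2,3)[OF assms(2,4,5)]
    unfolding path_expansion_def by auto
qed

lemma trivial_splines_iff_constant: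
  assumes "cring R" "p \<in> verts T \<rightarrow>\<^sub>E carrier R" "verts T \<noteq> {}"
  shows "p \<in> trivial_splines R T \<longleftrightarrow> (\<forall>i\<in>verts T. \<forall>j\<in>verts T. p i = p j)"
proof
  assume "p \<in> trivial_splines R T"
  then show "\<forall>i\<in>verts T. \<forall>j\<in>verts T. p i = p j" by (auto simp: trivial_splines_def)
next
  interpret cring R by fact
  assume const: "\<forall>i\<in>verts T. \<forall>j\<in>verts T. p i = p j"
  obtain i where i: "i \<in> verts T" using assms(3) by blast
  then have pi: "p i \<in> carrier R" using assms(2) by auto
  \<comment> \<open>Any vertex supplies the scalar. Both sides are extensional, so they need only be
    compared on \<open>verts T\<close>.\<close>
  have "p = (\<lambda>v\<in>verts T. p i \<otimes>\<^bsub>R\<^esub> \<one>\<^bsub>R\<^esub>)"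
  proof (rule extensionalityI[of _ "verts T"])
    show "p v = (\<lambda>v\<in>verts T. p i \<otimes>\<^bsub>R\<^esub> \<one>\<^bsub>R\<^esub>) v" if "v \<in> verts T" for v
      using bspec[OF bspec[OF const that] i] that pi by simp
  qed (use assms(2) in \<open>auto simp: PiE_def\<close>)
  then show "p \<in> trivial_splines R T" using pi unfolding trivial_splines_def by blast
qed

text \<open>A constant \<open>p\<close> has zero edge differences, and these are the values of
  \<open>a\<close>. Conversely, if \<open>a\<close> vanishes on all arcs, the expansion along the
  path from \<open>i\<close> to \<open>j\<close> adds only zeros to \<open>p i\<close>;
  connectedness enters through the existence of that path.\<close>

lemma constant_iff_path_expansion_zero:
  assumes "cring R" "undirected_tree T" "edge_labeling R T \<alpha>" "p \<in> verts T \<rightarrow>\<^sub>E carrier R"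
    and ex: "\<forall>i\<in>verts T. \<forall>j\<in>verts T. path_expansion R T \<alpha> p a i j"
  shows "(\<forall>i\<in>verts T. \<forall>j\<in>verts T. p i = p j) \<longleftrightarrow> (\<forall>(l, k)\<in>arcs_ends T. a l k = \<zero>\<^bsub>R\<^esub>)"
proof (intro iffI ballI)
  interpret cring R by fact
  interpret graph T using assms(2) by (simp add: undirected_tree_def)
  fix e
  assume const: "\<forall>i\<in>verts T. \<forall>j\<in>verts T. p i = p j" and e: "e \<in> arcs_ends T"
  obtain l k where lk: "e = (l, k)" by fastforce
  then have lk': "l \<in> verts T" "k \<in> verts T" using e adj_in_verts by auto
  then have "a l k = p k \<ominus>\<^bsub>R\<^esub> p l"
    using path_expansion_edge_difference[OF assms(1-4)] e lk ex by blast
  also have "p k = p l" using bspec[OF bspec[OF const lk'(2)] lk'(1)] .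
  also have "p l \<ominus>\<^bsub>R\<^esub> p l = \<zero>\<^bsub>R\<^esub>" using r_neg[of "p l"] PiE_mem[OF assms(4) lk'(1)] by (simp add: minus_eq)
  finally show "case e of (l, k) \<Rightarrow> a l k = \<zero>\<^bsub>R\<^esub>" using lk by simp
next
  interpret cring R by fact
  fix i j
  assume zero: "\<forall>(l, k)\<in>arcs_ends T. a l k = \<zero>\<^bsub>R\<^esub>" and i: "i \<in> verts T" and j: "j \<in> verts T"
  have "set (vwalk_arcs (tree_path T i j)) \<subseteq> arcs_ends T"
    using tree_path(1)[OF assms(2) i j] by (simp add: vpath_def vwalk_def)
  then have "\<forall>y\<in>set (map (\<lambda>(l, k). a l k) (vwalk_arcs (tree_path T i j))). y = \<zero>\<^bsub>R\<^esub>"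
    using zero by auto
  moreover have "p i \<in> carrier R" using assms(4) i by auto
  moreover have "path_expansion R T \<alpha> p a i j" using ex i j by blast
  ultimately show "p i = p j" using foldl_add_zeros by (simp add: path_expansion_def)
qed

theorem theorem4p1:
  fixes R :: "('r, 'm) ring_scheme"
    and T :: "('v, 'e) pre_digraph"
    and \<alpha> :: "'v set \<Rightarrow> 'r set"
    and p :: "'v \<Rightarrow> 'r"
  assumes "cring R"
    and "undirected_tree T"
    and "edge_labeling R T \<alpha>"
    and "p \<in> verts T \<rightarrow>\<^sub>E carrier R"
  shows "(p \<in> splines R T \<alpha> \<longleftrightarrow>
            (\<forall>i\<in>verts T. \<forall>j\<in>verts T. \<exists>a. path_expansion R T \<alpha> p a i j)) \<and>
         (p \<in> splines R T \<alpha> \<longrightarrow>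
            (\<exists>a. \<forall>i\<in>verts T. \<forall>j\<in>verts T. path_expansion R T \<alpha> p a i j)) \<and>
         (\<forall>a. (\<forall>i\<in>verts T. \<forall>j\<in>verts T. path_expansion R T \<alpha> p a i j) \<longrightarrow>
            (nontrivial_spline R T \<alpha> p \<longleftrightarrow> (\<exists>(l, k)\<in>arcs_ends T. a l k \<noteq> \<zero>\<^bsub>R\<^esub>)))"
proof (intro conjI allI impI)
  show iff: "p \<in> splines R T \<alpha> \<longleftrightarrow> (\<forall>i\<in>verts T. \<forall>j\<in>verts T. \<exists>a. path_expansion R T \<alpha> p a i j)"
    using spline_if_path_expansions[OF assms] spline_path_expansion[OF assms(1,2)] by blast
  show "\<exists>a. \<forall>i\<in>verts T. \<forall>j\<in>verts T. path_expansion R T \<alpha> p a i j" if "p \<in> splines R T \<alpha>"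
    using spline_path_expansion[OF assms(1,2) that] by blast
  fix a
  assume ex: "\<forall>i\<in>verts T. \<forall>j\<in>verts T. path_expansion R T \<alpha> p a i j"
  then have "p \<in> splines R T \<alpha>" using iff by blast
  \<comment> \<open>Nonemptiness is part of the library notion \<open>strongly_connected\<close>, on
    which \<open>connected\<close> rests.\<close>
  moreover have "verts T \<noteq> {}"
    using assms(2) by (auto simp: undirected_tree_def connected_def strongly_connected_def)
  ultimately show "nontrivial_spline R T \<alpha> p \<longleftrightarrow> (\<exists>(l, k)\<in>arcs_ends T. a l k \<noteq> \<zero>\<^bsub>R\<^esub>)"
    using trivial_splines_iff_constant[OF assms(1,4)] constant_iff_path_expansion_zero[OF assms ex]
    unfolding nontrivial_spline_def by fastforce
qed

end
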